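(* Let $p$ be a prime and $L\ge 0$ an integer. Let $W$ be the set of $p$-ary sequences whose period is $p^\ell$ for some integer $0\le \ell\le L$. Then $W$ is a linear subspace of $V(\mathbb{F}_p)$ of dimension $p^L$, and $\mathcal{B}=\left\{\left\{\binom{n}{k}\right\}_{n\ge 0} \;:\; 0\le k<p^L\right\}$ (the set of the first $p^L$ binomial sequences modulo $p$) is a basis of $W$.
   Context: A $p$-ary sequence is a sequence $\{s_n\}_{n\ge 0}$ with all terms in $\mathbb{F}_p$. $V(\mathbb{F}_p)$ is the $\mathbb{F}_p$-vector space of all $p$-ary sequences under termwise addition and scalar multiplication. The period of a periodic sequence is the least positive integer $T$ with $s_{n+T}=s_n$ for all $n\ge 0$. For an integer $k\ge 0$, the $k$-th ($p$-ary) binomial sequence $\left\{\binom{n}{k}\right\}_{n\ge0}$ has $n$-th term $\binom{n}{k}\bmod p$, with $\binom{n}{k}=0$ for $n<k$. *)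

theory Defs
  imports
    "Berlekamp_Zassenhaus.Finite_Field"
    "HOL-Library.Function_Algebras"
begin

text \<open>
  The prime field with \<open>p\<close> elements is \<^typ>\<open>'p::prime_card mod_ring\<close>, where
  \<open>p = CARD('p)\<close> and the class \<^class>\<open>prime_card\<close> says that \<open>CARD('p)\<close> is prime.
  The additive structure on sequences is the pointwise one of the function type.
\<close>

type_synonym 'p pseq = "nat \<Rightarrow> 'p mod_ring"

definition seq_scale :: "'p::prime_card mod_ring \<Rightarrow> 'p pseq \<Rightarrow> 'p pseq" where
  "seq_scale c s = (\<lambda>n. c * s n)"

global_interpretation pseq: vector_space "seq_scale :: 'p::prime_card mod_ring \<Rightarrow> 'p pseq \<Rightarrow> 'p pseq"
  by unfold_locales (auto simp: seq_scale_def fun_eq_iff algebra_simps)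

definition periodic_seq :: "(nat \<Rightarrow> 'a) \<Rightarrow> bool" where
  "periodic_seq s \<longleftrightarrow> (\<exists>T>0. \<forall>n. s (n + T) = s n)"

text \<open>Meaningful only for periodic sequences; otherwise the \<open>LEAST\<close> is unspecified.\<close>

definition seq_period :: "(nat \<Rightarrow> 'a) \<Rightarrow> nat" where
  "seq_period s = (LEAST T. T > 0 \<and> (\<forall>n. s (n + T) = s n))"

definition binomial_seq :: "nat \<Rightarrow> 'p::prime_card pseq" where
  "binomial_seq k = (\<lambda>n. of_nat (n choose k))"

definition period_space :: "nat \<Rightarrow> 'p::prime_card pseq set" where
  "period_space L = {s. periodic_seq s \<and> (\<exists>l\<le>L. seq_period s = CARD('p) ^ l)}"

end

theory Submission imports Defs begin

text \<open>
  Periods dividing \<open>p ^ L\<close> are exactly the powers \<open>p ^ l\<close> with \<open>l \<le> L\<close>, so \<open>W\<close> consists of the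
  sequences invariant under the shift by \<open>q = p ^ L\<close>. Since \<open>p\<close> divides \<open>q choose i\<close> for
  \<open>0 < i < q\<close>, Vandermonde's identity shows that the binomial sequences below \<open>q\<close> are
  \<open>q\<close>-periodic. The \<open>k\<close>-th one vanishes before \<open>k\<close> and equals one at \<open>k\<close>; by this triangularity
  they are independent and interpolate any prescribed values at \<open>0, \<dots>, q - 1\<close>, which determine
  a \<open>q\<close>-periodic sequence.
\<close>

lemma shift_mult:
  fixes s :: "nat \<Rightarrow> 'a"
  assumes "\<And>n. s (n + T) = s n"
  shows "s (n + k * T) = s n"
proof (induction k)
  case (Suc k)
  have "n + Suc k * T = (n + k * T) + T" by simp
  then show ?case using assms Suc.IH by metis
qed simp

text \<open>The remainder of \<open>Q\<close> modulo the least period is again a shift that fixes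
  \<open>s\<close>, so minimality forces it to be 0.\<close>

lemma seq_period_dvd:
  fixes s :: "nat \<Rightarrow> 'a"
  assumes "Q > 0" and "\<And>n. s (n + Q) = s n"
  shows "seq_period s dvd Q"
proof -
  define T where "T = seq_period s"
  have T: "T > 0 \<and> (\<forall>n. s (n + T) = s n)"
    unfolding T_def seq_period_def by (rule LeastI[of _ Q]) (use assms in auto)
  have "s (n + Q mod T) = s n" for n
    \<comment> \<open>Moving on from \<open>n + Q mod T\<close> by \<open>Q div T\<close> periods
      lands exactly at \<open>n + Q\<close>.\<close>
    using shift_mult[of s T "n + Q mod T" "Q div T"] T assms(2)[of n]
    by (simp add: add.assoc)
  moreover have "\<not> (Q mod T > 0 \<and> (\<forall>n. s (n + Q mod T) = s n))"
    by (rule not_less_Least) (use T in \<open>simp flip: seq_period_def T_def\<close>)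
  ultimately show ?thesis
    unfolding T_def[symmetric] by auto
qed

text \<open>Replaces the condition on the least period by a linear one, from which closure under
  sums and scalars is immediate.\<close>

lemma period_space_eq:
  "period_space L = {s :: 'p::prime_card pseq. \<forall>n. s (n + CARD('p) ^ L) = s n}"
proof (intro equalityI subsetI CollectI allI)
  fix s :: "'p pseq" and n
  assume "s \<in> period_space L"
  then obtain l where per: "periodic_seq s" and l: "l \<le> L" "seq_period s = CARD('p) ^ l"
    by (auto simp: period_space_def)
  \<comment> \<open>Some positive period must be exhibited before the \<open>LEAST\<close> in
    \<open>seq_period\<close> can be used.\<close>
  from per obtain T where "T > 0 \<and> (\<forall>n. s (n + T) = s n)"
    by (auto simp: periodic_seq_def)
  then have *: "seq_period s > 0 \<and> (\<forall>n. s (n + seq_period s) = s n)"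
    unfolding seq_period_def by (rule LeastI)
  have "CARD('p) ^ L = CARD('p) ^ (L - l) * seq_period s"
    using l by (simp flip: power_add)
  then show "s (n + CARD('p) ^ L) = s n"
    using * shift_mult[of s] by simp
next
  fix s :: "'p pseq"
  assume "s \<in> {s. \<forall>n. s (n + CARD('p) ^ L) = s n}"
  then have s: "\<And>n. s (n + CARD('p) ^ L) = s n" by simp
  have pos: "CARD('p) ^ L > 0" by simp
  have "prime CARD('p)" by (rule prime_card)
  then have "\<exists>l\<le>L. seq_period s = CARD('p) ^ l"
    using seq_period_dvd[of _ s, OF pos s] by (simp add: divides_primepow_nat)
  moreover have "periodic_seq s"
    unfolding periodic_seq_def using s pos by blast
  ultimately show "s \<in> period_space L"
    by (simp add: period_space_def)
qed

text \<open>By absorption, \<open>i * (q choose i)\<close> is a multiple of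
  \<open>q = p ^ L\<close>. Were the binomial coefficient prime to \<open>p\<close>, then
  \<open>q\<close> would divide \<open>i\<close>, which is positive and smaller than
  \<open>q\<close>.\<close>

lemma prime_dvd_prime_power_choose:
  fixes p :: nat
  assumes "prime p" "0 < i" "i < p ^ L"
  shows "p dvd (p ^ L choose i)"
proof (rule ccontr)
  assume "\<not> p dvd (p ^ L choose i)"
  then have "coprime (p ^ L) (p ^ L choose i)"
    using assms(1) by (simp add: prime_imp_coprime)
  moreover have "p ^ L dvd i * (p ^ L choose i)"
    using assms(2) by (metis times_binomial_minus1_eq dvd_triv_left)
  ultimately have "p ^ L dvd i"
    by (simp add: coprime_dvd_mult_left_iff)
  with assms show False
    by (auto dest: dvd_imp_le)
qed

lemma of_nat_mod_ring_eq_0: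
  assumes "CARD('p) dvd n"
  shows "(of_nat n :: 'p::prime_card mod_ring) = 0"
  using assms by (simp add: of_nat_eq_0_iff_char_dvd)

lemma binomial_seq_shift:
  assumes "k < CARD('p) ^ L"
  shows "(binomial_seq k :: 'p::prime_card pseq) (n + CARD('p) ^ L) = binomial_seq k n"
proof -
  let ?q = "CARD('p) ^ L"
  \<comment> \<open>The bound on \<open>k\<close> keeps every index of the Vandermonde sum below
    \<open>?q\<close>, so only the term at 0 survives modulo \<open>p\<close>.\<close>
  have zero: "(of_nat (?q choose i) :: 'p mod_ring) = 0" if "i \<in> {..k} - {0}" for i
    using that assms
    by (intro of_nat_mod_ring_eq_0 prime_dvd_prime_power_choose[OF prime_card]) auto
  have "(of_nat ((n + ?q) choose k) :: 'p mod_ring)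
      = (\<Sum>i\<le>k. of_nat (?q choose i) * of_nat (n choose (k - i)))"
    by (simp add: add.commute[of n] flip: vandermonde)
  also have "\<dots> = (\<Sum>i\<in>{0}. of_nat (?q choose i) * of_nat (n choose (k - i)))"
    by (rule sum.mono_neutral_right) (use zero in auto)
  finally show ?thesis
    by (simp add: binomial_seq_def)
qed

lemma binomial_seq_below [simp]: "n < k \<Longrightarrow> binomial_seq k n = 0"
  and binomial_seq_diag [simp]: "binomial_seq k k = 1"
  by (simp_all add: binomial_seq_def binomial_eq_0)

text \<open>Needed to count the basis: distinct indices below \<open>p ^ L\<close> give distinct
  sequences.\<close>

lemma inj_binomial_seq: "inj (binomial_seq :: nat \<Rightarrow> 'p::prime_card pseq)"
proof (rule linorder_injI)
  fix j k :: nat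
  assume "j < k"
  then have "(binomial_seq k :: 'p pseq) j \<noteq> binomial_seq j j" by simp
  then show "(binomial_seq j :: 'p pseq) \<noteq> binomial_seq k" by metis
qed

text \<open>The lower end \<open>m\<close> varies so that sequences can be added from the top down:
  everything in the span of the later ones vanishes at \<open>m\<close>, whereas
  \<open>binomial_seq m\<close> is 1 there.\<close>

lemma independent_binomial_seq:
  assumes "m \<le> q"
  shows "pseq.independent ((binomial_seq :: nat \<Rightarrow> 'p::prime_card pseq) ` {m..<q})"
  using assms
proof (induction m rule: inc_induct)
  case base
  show ?case by (simp add: pseq.independent_empty)
next
  case (step m)
  have "pseq.span (binomial_seq ` {Suc m..<q}) \<subseteq> {s :: 'p pseq. s m = 0}"
    by (rule pseq.span_minimal) (auto simp: pseq.subspace_def seq_scale_def)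
  then have "(binomial_seq m :: 'p pseq) \<notin> pseq.span (binomial_seq ` {Suc m..<q})"
    by auto
  moreover have "{m..<q} = insert m {Suc m..<q}"
    using step.hyps by auto
  ultimately show ?case
    using step.IH by (simp add: pseq.independent_insertI)
qed

text \<open>This is Newton's forward interpolation, one node at a time.\<close>

lemma binomial_seq_interpolation:
  "\<exists>v \<in> pseq.span (binomial_seq ` {..<m}). \<forall>n<m. v n = (s :: 'p::prime_card pseq) n"
proof (induction m)
  case 0
  show ?case using pseq.span_zero by auto
next
  case (Suc m)
  then obtain v where v: "v \<in> pseq.span (binomial_seq ` {..<m})" "\<And>n. n < m \<Longrightarrow> v n = s n"
    by blast
  \<comment> \<open>The added multiple corrects the value at \<open>m\<close> and leaves the earlier
    values alone.\<close>
  let ?w = "v + seq_scale (s m - v m) (binomial_seq m)"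
  have "v \<in> pseq.span (binomial_seq ` {..<Suc m})"
    by (rule subsetD[OF pseq.span_mono v(1)]) auto
  then have "?w \<in> pseq.span (binomial_seq ` {..<Suc m})"
    by (intro pseq.span_add pseq.span_scale) (auto intro: pseq.span_base)
  moreover have "?w n = s n" if "n < Suc m" for n
    using that v(2) by (auto simp: less_Suc_eq seq_scale_def)
  ultimately show ?case by blast
qed

lemma subspace_period_space: "pseq.subspace (period_space L :: 'p::prime_card pseq set)"
  by (simp add: period_space_eq pseq.subspace_def seq_scale_def)

lemma span_binomial_seq:
  "pseq.span (binomial_seq ` {..<CARD('p) ^ L}) = (period_space L :: 'p::prime_card pseq set)"
proof (rule equalityI)
  let ?q = "CARD('p) ^ L"
  show sub: "pseq.span (binomial_seq ` {..<?q}) \<subseteq> (period_space L :: 'p pseq set)"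
    by (rule pseq.span_minimal[OF _ subspace_period_space])
       (auto simp: period_space_eq binomial_seq_shift)
  show "(period_space L :: 'p pseq set) \<subseteq> pseq.span (binomial_seq ` {..<?q})"
  proof
    fix s :: "'p pseq"
    assume "s \<in> period_space L"
    then have s: "s (n + ?q) = s n" for n by (simp add: period_space_eq)
    obtain v where v: "v \<in> pseq.span (binomial_seq ` {..<?q})" "\<And>n. n < ?q \<Longrightarrow> v n = s n"
      using binomial_seq_interpolation by metis
    have v_shift: "v (n + ?q) = v n" for n
      using v(1) sub by (auto simp: period_space_eq)
    \<comment> \<open>Agreement on one block of length \<open>?q\<close> spreads to all indices,
      since both sequences are invariant under the shift by \<open>?q\<close>.\<close>
    have "v n = s n" for n
    proof (induction n rule: less_induct)
      case (less n)
      show ?case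
      proof (cases "n < ?q")
        case False
        then have "v (n - ?q) = s (n - ?q)" by (intro less diff_less) (use False in \<open>auto intro: gr0I\<close>)
        with False show ?thesis using v_shift[of "n - ?q"] s[of "n - ?q"] by simp
      qed (rule v(2))
    qed
    then show "s \<in> pseq.span (binomial_seq ` {..<?q})"
      using v(1) by (metis ext)
  qed
qed

theorem corollary19:
  fixes L :: nat
  defines "W \<equiv> period_space L :: 'p::prime_card pseq set"
  defines "\<B> \<equiv> {binomial_seq k | k. k < CARD('p) ^ L} :: 'p pseq set"
  shows "pseq.subspace W \<and> pseq.dim W = CARD('p) ^ L \<and>
         \<B> \<subseteq> W \<and> pseq.independent \<B> \<and> pseq.span \<B> = W"
proof -
  have B: "\<B> = binomial_seq ` {..<CARD('p) ^ L}"
    unfolding \<B>_def by auto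
  have span: "pseq.span \<B> = W"
    unfolding B W_def by (rule span_binomial_seq)
  have indep: "pseq.independent \<B>"
    unfolding B lessThan_atLeast0 by (rule independent_binomial_seq) simp
  have "card \<B> = CARD('p) ^ L"
    unfolding B by (simp add: card_image inj_on_subset[OF inj_binomial_seq])
  then have "pseq.dim W = CARD('p) ^ L"
    using pseq.dim_span_eq_card_independent[OF indep] span by simp
  moreover have "\<B> \<subseteq> W"
    using pseq.span_superset span by blast
  ultimately show ?thesis
    using subspace_period_space span indep unfolding W_def by blast
qed

end
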